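(* Let $G$ be a nontrivial finite group. Then the following conditions are equivalent: (a) $\mathcal{P}^\ast(G)$ is a bipartite graph; (b) $\pi_e(G)\subseteq\{1,2,3\}$.
   Context: For a group $G$, $\mathcal{P}^\ast(G)$ is the simple undirected graph with vertex set $G\setminus\{1\}$ in which two distinct vertices $x,y$ are adjacent if and only if $y=x^m$ or $x=y^m$ for some positive integer $m$. A graph is bipartite if its vertex set can be partitioned into two independent sets (one of which may be empty); in particular edgeless graphs are regarded as bipartite. $\pi_e(G)$ (the spectrum of $G$) is the set of orders of elements of $G$. *)

theory Defs
  imports "HOL-Algebra.Multiplicative_Group" "HOL-Algebra.Elementary_Groups"
    "Graph_Theory.Pair_Digraph"
begin

text \<open>Undirected graphs are symmetric digraphs, as in Graph_Theory: each edge is represented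
  by its two opposite arcs, and a finite simple graph is a \<^locale>\<open>pair_graph\<close>.\<close>

definition independent_set :: "('a, 'b) pre_digraph \<Rightarrow> 'a set \<Rightarrow> bool" where
  "independent_set \<Gamma> S \<longleftrightarrow> S \<subseteq> verts \<Gamma> \<and> (\<forall>u\<in>S. \<forall>v\<in>S. (u, v) \<notin> arcs_ends \<Gamma>)"

text \<open>The parts may be empty, so edgeless graphs are bipartite.\<close>

definition bipartite :: "('a, 'b) pre_digraph \<Rightarrow> bool" where
  "bipartite \<Gamma> \<longleftrightarrow> (\<exists>A B. verts \<Gamma> = A \<union> B \<and> A \<inter> B = {} \<and>
     independent_set \<Gamma> A \<and> independent_set \<Gamma> B)"

definition reduced_power_graph :: "('a, 'm) monoid_scheme \<Rightarrow> 'a pair_pre_digraph" where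
  "reduced_power_graph G =
     \<lparr> pverts = carrier G - {\<one>\<^bsub>G\<^esub>},
       parcs = {(x, y). x \<in> carrier G - {\<one>\<^bsub>G\<^esub>} \<and> y \<in> carrier G - {\<one>\<^bsub>G\<^esub>} \<and> x \<noteq> y \<and>
         (\<exists>m::nat. m > 0 \<and> (y = x [^]\<^bsub>G\<^esub> m \<or> x = y [^]\<^bsub>G\<^esub> m))} \<rparr>"

lemma pair_graph_reduced_power_graph:
  assumes "finite (carrier G)"
  shows "pair_graph (reduced_power_graph G)"
proof
  show "finite (parcs (reduced_power_graph G))"
    by (rule finite_subset[of _ "carrier G \<times> carrier G"])
      (auto simp: reduced_power_graph_def assms)
qed (auto simp: reduced_power_graph_def assms symmetric_def sym_def arcs_ends_conv)

definition spectrum :: "('a, 'm) monoid_scheme \<Rightarrow> nat set" where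
  "spectrum G = group.ord G ` carrier G"

end

theory Submission
  imports Defs
begin

text \<open>If \<open>x\<close> has order at least 4, then \<open>x\<close>, \<open>x\<^sup>-\<^sup>1\<close> and \<open>x\<^sup>2\<close> form a triangle, since both \<open>x\<close> and
  \<open>x\<^sup>-\<^sup>1\<close> generate the cyclic subgroup of \<open>x\<close>. If all orders are at most 3, every edge joins an
  element to its inverse, so the edges form a matching, and choosing one element from each pair
  \<open>{x, x\<^sup>-\<^sup>1}\<close> gives a bipartition.\<close>

text \<open>Pigeonhole: two of the three vertices would share one of the two parts, although they
  are adjacent.\<close>

lemma bipartite_no_triangle:
  assumes "bipartite \<Gamma>" "{x, y, z} \<subseteq> verts \<Gamma>"
    and "(x, y) \<in> arcs_ends \<Gamma>" "(y, z) \<in> arcs_ends \<Gamma>" "(x, z) \<in> arcs_ends \<Gamma>"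
  shows False
proof -
  obtain A B where "verts \<Gamma> = A \<union> B" and "independent_set \<Gamma> A" "independent_set \<Gamma> B"
    using assms(1) by (auto simp: bipartite_def)
  then have "x \<in> A \<or> x \<in> B" "y \<in> A \<or> y \<in> B" "z \<in> A \<or> z \<in> B"
    and "\<And>u v. (u, v) \<in> arcs_ends \<Gamma> \<Longrightarrow> \<not> (u \<in> A \<and> v \<in> A)"
    and "\<And>u v. (u, v) \<in> arcs_ends \<Gamma> \<Longrightarrow> \<not> (u \<in> B \<and> v \<in> B)"
    using assms(2) by (auto simp: independent_set_def)
  then show False
    using assms(3-5) by metis
qed

lemma reduced_power_graph_arc_iff:
  "(x, y) \<in> parcs (reduced_power_graph G) \<longleftrightarrow>
    x \<in> carrier G - {\<one>\<^bsub>G\<^esub>} \<and> y \<in> carrier G - {\<one>\<^bsub>G\<^esub>} \<and> x \<noteq> y \<and>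
    (\<exists>m::nat. m > 0 \<and> (y = x [^]\<^bsub>G\<^esub> m \<or> x = y [^]\<^bsub>G\<^esub> m))"
  by (simp add: reduced_power_graph_def)

lemma reduced_power_graph_arcI:
  fixes m :: nat
  assumes "x \<in> carrier G" "y \<in> carrier G" "x \<noteq> \<one>\<^bsub>G\<^esub>" "y \<noteq> \<one>\<^bsub>G\<^esub>" "x \<noteq> y"
    and "y = x [^]\<^bsub>G\<^esub> m" "m > 0"
  shows "(x, y) \<in> parcs (reduced_power_graph G)"
  unfolding reduced_power_graph_arc_iff using assms by blast

context group
begin

lemma inv_eq_pow_ord_minus:
  assumes x: "x \<in> carrier G" and "k \<le> ord x"
  shows "inv (x [^] k) = x [^] (ord x - k)"
proof (rule inv_equality)
  show "x [^] (ord x - k) \<otimes> x [^] k = \<one>"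
    using assms by (simp add: nat_pow_mult)
qed (use x in auto)

lemma reduced_power_graph_triangle:
  assumes x: "x \<in> carrier G" and n: "ord x \<ge> 4"
  shows "(x, inv x) \<in> parcs (reduced_power_graph G)"
    and "(inv x, x [^] (2::nat)) \<in> parcs (reduced_power_graph G)"
    and "(x, x [^] (2::nat)) \<in> parcs (reduced_power_graph G)"
proof -
  have ne: "x [^] k \<noteq> \<one>" if "0 < k" "k < 4" for k :: nat
    using that n x by (auto simp: pow_eq_id dest: dvd_imp_le)
  have pow2: "x [^] (2::nat) = x \<otimes> x"
    using x by (simp add: numeral_2_eq_2)
  have pow3: "x [^] (3::nat) = x \<otimes> x \<otimes> x"
    using x by (simp add: numeral_3_eq_3)
  \<comment> \<open>These separate the vertices: \<open>x1\<close> parts \<open>x\<close> from its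
    square, \<open>x2\<close> parts \<open>x\<close> from \<open>inv x\<close>, and
    \<open>x3\<close> parts \<open>inv x\<close> from the square of \<open>x\<close>.\<close>
  have x1: "x \<noteq> \<one>" and x2: "x \<otimes> x \<noteq> \<one>" and x3: "x \<otimes> x \<otimes> x \<noteq> \<one>"
    using ne[of 1] ne[of 2] ne[of 3] x pow2 pow3 by auto
  \<comment> \<open>Adjacency asks for a positive natural exponent, so the inverse is rewritten as
    such a power.\<close>
  have inv_pow: "inv x = x [^] (ord x - 1)"
    using inv_eq_pow_ord_minus[of x 1] x n by simp
  \<comment> \<open>The square of \<open>x\<close> is the inverse of
    \<open>x [^] (ord x - 2)\<close>, and inversion commutes with powers.\<close>
  have sq_pow: "x [^] (2::nat) = inv x [^] (ord x - 2)"
    using inv_eq_pow_ord_minus[of x "ord x - 2"] x n by (simp add: nat_pow_inv)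
  have "x \<noteq> inv x"
    using x x2 by (metis r_inv)
  then show "(x, inv x) \<in> parcs (reduced_power_graph G)"
    using x x1 n by (intro reduced_power_graph_arcI[OF _ _ _ _ _ inv_pow]) auto
  have "inv x \<noteq> x [^] (2::nat)"
    using x x3 by (metis pow2 l_inv)
  then show "(inv x, x [^] (2::nat)) \<in> parcs (reduced_power_graph G)"
    using x x1 ne[of 2] n by (intro reduced_power_graph_arcI[OF _ _ _ _ _ sq_pow]) auto
  have "x \<noteq> x [^] (2::nat)"
    using x x1 pow2 by simp
  then show "(x, x [^] (2::nat)) \<in> parcs (reduced_power_graph G)"
    using x x1 ne[of 2] by (intro reduced_power_graph_arcI[OF _ _ _ _ _ refl]) auto
qed

text \<open>The exponent counts only modulo \<open>ord x\<close>, and the two inequalities exclude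
  the residues 0 and 1.\<close>

lemma pow_eq_inv_if_ord_le_3:
  fixes m :: nat
  assumes x: "x \<in> carrier G" and ord: "ord x \<in> {1, 2, 3}"
    and ne: "x [^] m \<noteq> \<one>" "x [^] m \<noteq> x"
  shows "x [^] m = inv x"
proof -
  define r where "r = m mod ord x"
  have "x [^] m = x [^] (ord x * (m div ord x) + r)"
    by (simp add: r_def)
  also have "\<dots> = (x [^] ord x) [^] (m div ord x) \<otimes> x [^] r"
    using x by (simp add: nat_pow_mult nat_pow_pow del: pow_ord_eq_1)
  finally have eq: "x [^] m = x [^] r"
    using x by simp
  have "r \<noteq> 0" "r \<noteq> 1"
    using ne x by (metis eq nat_pow_0, metis eq nat_pow_eone)
  moreover have "r < ord x"
    using ord by (auto simp: r_def)
  \<comment> \<open>Orders 1 and 2 leave no residue at all and are contradictory; order 3 leaves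
    only 2.\<close>
  ultimately have "r = ord x - 1"
    using ord by auto
  then show ?thesis
    using eq inv_eq_pow_ord_minus[of x 1] x ord by auto
qed

lemma reduced_power_graph_arc_inv:
  assumes "spectrum G \<subseteq> {1, 2, 3}" and "(x, y) \<in> parcs (reduced_power_graph G)"
  shows "y = inv x"
proof -
  have ord: "ord z \<in> {1, 2, 3}" if "z \<in> carrier G" for z
    using assms(1) that by (auto simp: spectrum_def)
  from assms(2) obtain m :: nat where xy: "x \<in> carrier G" "y \<in> carrier G"
    and ne: "x \<noteq> \<one>" "y \<noteq> \<one>" "x \<noteq> y" and "y = x [^] m \<or> x = y [^] m"
    by (auto simp: reduced_power_graph_arc_iff)
  \<comment> \<open>Either endpoint may be the power of the other; both cases agree because
    inversion is an involution.\<close>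
  then have "y = inv x \<or> x = inv y"
    using pow_eq_inv_if_ord_le_3 ord by metis
  then show ?thesis
    using xy by auto
qed

lemma bipartite_if_arcs_inv:
  assumes arcs: "\<And>x y. (x, y) \<in> parcs (reduced_power_graph G) \<Longrightarrow> y = inv x"
  shows "bipartite (with_proj (reduced_power_graph G))"
proof -
  \<comment> \<open>The choice depends only on the unordered pair, so \<open>x\<close> and
    \<open>inv x\<close> get the same representative. The parts are the representatives and the
    remaining vertices.\<close>
  define c where "c x = (SOME z. z \<in> {x, inv x})" for x
  have c: "c x \<in> {x, inv x}" for x
    unfolding c_def by (rule someI[of _ x]) simp
  have c_inv: "c (inv x) = c x" if "x \<in> carrier G" for x
    using that by (simp add: c_def insert_commute)
  have arc: "x \<noteq> y \<and> y = inv x \<and> c y = c x"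
    if "(x, y) \<in> parcs (reduced_power_graph G)" for x y
    using that arcs[OF that] c_inv by (simp add: reduced_power_graph_arc_iff)
  let ?V = "pverts (reduced_power_graph G)"
  \<comment> \<open>An arc would force \<open>x = c x = c y = y\<close>.\<close>
  have "(x, y) \<notin> parcs (reduced_power_graph G)" if "c x = x" "c y = y" for x y
    using arc that by metis
  then have "independent_set (with_proj (reduced_power_graph G)) {x \<in> ?V. c x = x}"
    by (simp add: independent_set_def)
  \<comment> \<open>On an arc, \<open>c x \<noteq> x\<close> leaves \<open>c x = inv x = y\<close>,
    hence \<open>c y = y\<close>.\<close>
  moreover have "(x, y) \<notin> parcs (reduced_power_graph G)" if "c x \<noteq> x" "c y \<noteq> y" for x y
    using arc[of x y] c[of x] that by auto
  then have "independent_set (with_proj (reduced_power_graph G)) {x \<in> ?V. c x \<noteq> x}"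
    by (simp add: independent_set_def)
  ultimately show ?thesis
    unfolding bipartite_def
    by (intro exI[of _ "{x \<in> ?V. c x = x}"] exI[of _ "{x \<in> ?V. c x \<noteq> x}"]) auto
qed

end

theorem theorem4:
  fixes G :: "('a, 'm) monoid_scheme"
  assumes "group G"
    and "finite (carrier G)"
    and "\<not> trivial_group G"
  shows "bipartite (with_proj (reduced_power_graph G)) \<longleftrightarrow> spectrum G \<subseteq> {1, 2, 3}"
proof -
  interpret group G by fact
  show ?thesis
  proof
    assume bip: "bipartite (with_proj (reduced_power_graph G))"
    show "spectrum G \<subseteq> {1, 2, 3}"
    proof (rule ccontr)
      assume "\<not> spectrum G \<subseteq> {1, 2, 3}"
      then obtain x where x: "x \<in> carrier G" and "ord x \<notin> {1, 2, 3}"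
        by (auto simp: spectrum_def)
      \<comment> \<open>\<open>ord\<close> is 0 on elements of infinite order; finiteness excludes
        this value.\<close>
      moreover have "ord x \<ge> 1"
        using ord_ge_1 assms(2) x by blast
      ultimately have "ord x \<ge> 4"
        by auto
      note triangle = reduced_power_graph_triangle[OF x this]
      have "{x, inv\<^bsub>G\<^esub> x, x [^]\<^bsub>G\<^esub> (2::nat)} \<subseteq> pverts (reduced_power_graph G)"
        using triangle by (auto simp: reduced_power_graph_def)
      then show False
        using bipartite_no_triangle[OF bip] triangle by simp
    qed
  next
    assume "spectrum G \<subseteq> {1, 2, 3}"
    then show "bipartite (with_proj (reduced_power_graph G))"
      using bipartite_if_arcs_inv reduced_power_graph_arc_inv by blast
  qed
qed

end
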